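(* Let $\Gamma$ be a discrete subgroup of $SL(2,\mathbb{R})$, $m\ge0$ and $\xi$ integers, and $\alpha\in\widetilde{\Gamma}$. Then $\mathcal{Q}^m_\xi\circ T^Q_\xi(\alpha)=T^P_\xi(\alpha)\circ\mathcal{Q}^m_\xi$ as maps on $QM^m_\xi(\Gamma)$, and $\mathfrak{S}_m\circ T^P_\xi(\alpha)=T_{\xi-2m}(\alpha)\circ\mathfrak{S}_m$ as maps on $QP^m_\xi(\Gamma)$.
   Context: $\mathcal{F}$ is the ring of holomorphic functions on the upper half plane $\mathcal{H}$; $\mathcal{F}_m[X]$ polynomials of degree $\le m$ over $\mathcal{F}$. For $\alpha=\begin{pmatrix} a&b\\ c&d\end{pmatrix}\in GL^+(2,\mathbb{R})$: $\alpha z=(az+b)/(cz+d)$, $\mathfrak{J}(\alpha,z)=cz+d$, $\mathfrak{K}(\alpha,z)=c/(cz+d)$; $(f\mid_w\alpha)(z)=\det(\alpha)^{w/2}\mathfrak{J}(\alpha,z)^{-w}f(\alpha z)$; $(F\,\|_w\,\alpha)(z,X)=\det(\alpha)^{w/2}\mathfrak{J}(\alpha,z)^{-w}F(\alpha z,\det(\alpha)^{-1}\mathfrak{J}(\alpha,z)^2(X-\mathfrak{K}(\alpha,z)))$. $M_w(\Gamma)=\{f\in\mathcal{F}:f\mid_w\gamma=f\ \forall\gamma\in\Gamma\}$; $QP^m_w(\Gamma)=\{F\in\mathcal{F}_m[X]:F\,\|_w\,\gamma=F\ \forall\gamma\in\Gamma\}$; $QM^m_\xi(\Gamma)$ is the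 set of $f\in\mathcal{F}$ for which there are $f_0,\dots,f_m\in\mathcal{F}$ with $(f\mid_\xi\gamma)(z)=\sum_{r=0}^mf_r(z)\mathfrak{K}(\gamma,z)^r$ for all $z,\gamma\in\Gamma$ (the $f_r$ being determined by $f$), and $(\mathcal{Q}^m_\xi f)(z,X)=\sum_r f_r(z)X^r$. For $F=\sum_kg_kX^k$, $\mathfrak{S}_\ell F=g_\ell$. The commensurator $\widetilde\Gamma$ is the set of $g\in GL^+(2,\mathbb{R})$ with $g\Gamma g^{-1}\cap\Gamma$ of finite index in both; for $\alpha\in\widetilde\Gamma$ write $\Gamma\alpha\Gamma=\coprod_{i=1}^s\Gamma\alpha_i$. Hecke operators: $T_w(\alpha)f=\sum_i f\mid_w\alpha_i$ on $M_w(\Gamma)$; $T^P_\xi(\alpha)F=\sum_iF\,\|_\xi\,\alpha_i$ on $QP^m_\xi(\Gamma)$; $T^Q_\xi(\alpha)f=\sum_i\mathfrak{S}_0((\mathcal{Q}^m_\xi f)\,\|_\xi\,\alpha_i)$ on $QM^m_\xi(\Gamma)$. *)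

theory Defs
  imports
    "HOL-Analysis.Analysis"
    "HOL-Algebra.Coset"
    "HOL-Computational_Algebra.Polynomial"
begin

definition upper_half_plane :: "complex set" where
  "upper_half_plane = {z. Im z > 0}"

text \<open>The groups \<open>GL\<^sup>+(2,\<real>)\<close> and \<open>SL(2,\<real>)\<close>; discreteness of subgroups refers to the
  Euclidean topology of the type \<^typ>\<open>real^2^2\<close>, which induces the usual one.\<close>

definition GL2_pos :: "(real^2^2) monoid" where
  "GL2_pos = \<lparr>carrier = {A. det A > 0}, mult = (**), one = mat 1\<rparr>"

definition SL2 :: "(real^2^2) monoid" where
  "SL2 = \<lparr>carrier = {A. det A = 1}, mult = (**), one = mat 1\<rparr>"

definition moebius :: "real^2^2 \<Rightarrow> complex \<Rightarrow> complex" where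
  "moebius \<alpha> z = (complex_of_real (\<alpha>$1$1) * z + complex_of_real (\<alpha>$1$2)) /
                 (complex_of_real (\<alpha>$2$1) * z + complex_of_real (\<alpha>$2$2))"

definition fac_J :: "real^2^2 \<Rightarrow> complex \<Rightarrow> complex" where
  "fac_J \<alpha> z = complex_of_real (\<alpha>$2$1) * z + complex_of_real (\<alpha>$2$2)"

definition fac_K :: "real^2^2 \<Rightarrow> complex \<Rightarrow> complex" where
  "fac_K \<alpha> z = complex_of_real (\<alpha>$2$1) / fac_J \<alpha> z"

text \<open>Functions on the upper half plane are total functions on \<^typ>\<open>complex\<close> whose values
  outside the half plane are irrelevant: all conditions and equalities are imposed only on
  \<^const>\<open>upper_half_plane\<close>.\<close>

definition slash :: "int \<Rightarrow> (complex \<Rightarrow> complex) \<Rightarrow> real^2^2 \<Rightarrow> complex \<Rightarrow> complex" where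
  "slash w f \<alpha> z = complex_of_real (det \<alpha> powr (of_int w / 2)) * fac_J \<alpha> z powi (- w)
                     * f (moebius \<alpha> z)"

text \<open>An element of \<open>\<F>\<^sub>m[X]\<close> is represented by the function sending \<open>z\<close> to the
  polynomial in \<open>X\<close> obtained by evaluating all coefficients at \<open>z\<close>.\<close>

definition hol_polys :: "nat \<Rightarrow> (complex \<Rightarrow> complex poly) set" where
  "hol_polys m = {F. (\<forall>z\<in>upper_half_plane. degree (F z) \<le> m) \<and>
                     (\<forall>r. (\<lambda>z. coeff (F z) r) holomorphic_on upper_half_plane)}"

text \<open>The linear polynomial substituted for \<open>X\<close> below is \<open>det(\<alpha>)\<^sup>-\<^sup>1 J(\<alpha>,z)\<^sup>2 (X - K(\<alpha>,z))\<close>.\<close>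

definition slash_poly ::
  "int \<Rightarrow> (complex \<Rightarrow> complex poly) \<Rightarrow> real^2^2 \<Rightarrow> complex \<Rightarrow> complex poly" where
  "slash_poly w F \<alpha> z =
     smult (complex_of_real (det \<alpha> powr (of_int w / 2)) * fac_J \<alpha> z powi (- w))
       (pcompose (F (moebius \<alpha> z))
         (smult (inverse (complex_of_real (det \<alpha>)) * (fac_J \<alpha> z)\<^sup>2) [:- fac_K \<alpha> z, 1:]))"

definition modular_forms :: "int \<Rightarrow> (real^2^2) set \<Rightarrow> (complex \<Rightarrow> complex) set" where
  "modular_forms w \<Gamma> = {f. f holomorphic_on upper_half_plane \<and>
     (\<forall>\<gamma>\<in>\<Gamma>. \<forall>z\<in>upper_half_plane. slash w f \<gamma> z = f z)}"

definition quasimodular_polys ::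
  "nat \<Rightarrow> int \<Rightarrow> (real^2^2) set \<Rightarrow> (complex \<Rightarrow> complex poly) set" where
  "quasimodular_polys m w \<Gamma> = {F. F \<in> hol_polys m \<and>
     (\<forall>\<gamma>\<in>\<Gamma>. \<forall>z\<in>upper_half_plane. slash_poly w F \<gamma> z = F z)}"

definition is_quasi_coeffs ::
  "nat \<Rightarrow> int \<Rightarrow> (real^2^2) set \<Rightarrow> (complex \<Rightarrow> complex) \<Rightarrow> (nat \<Rightarrow> complex \<Rightarrow> complex) \<Rightarrow> bool" where
  "is_quasi_coeffs m \<xi> \<Gamma> f c \<longleftrightarrow>
     (\<forall>r\<le>m. c r holomorphic_on upper_half_plane) \<and>
     (\<forall>\<gamma>\<in>\<Gamma>. \<forall>z\<in>upper_half_plane. slash \<xi> f \<gamma> z = (\<Sum>r\<le>m. c r z * fac_K \<gamma> z ^ r))"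

definition quasimodular_forms ::
  "nat \<Rightarrow> int \<Rightarrow> (real^2^2) set \<Rightarrow> (complex \<Rightarrow> complex) set" where
  "quasimodular_forms m \<xi> \<Gamma> = {f. f holomorphic_on upper_half_plane \<and>
     (\<exists>c. is_quasi_coeffs m \<xi> \<Gamma> f c)}"

text \<open>The convention that the coefficients \<open>f\<^sub>0, \<dots>, f\<^sub>m\<close> are determined by \<open>f\<close>, without which
  \<open>\<Q>\<^sup>m\<^sub>\<xi>\<close> is not a map. It can fail for small discrete groups: if every element of \<open>\<Gamma>\<close> has
  lower left entry \<open>0\<close>, then \<open>f\<^sub>1, \<dots>, f\<^sub>m\<close> are arbitrary.\<close>

definition quasi_coeffs_determined :: "nat \<Rightarrow> int \<Rightarrow> (real^2^2) set \<Rightarrow> bool" where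
  "quasi_coeffs_determined m \<xi> \<Gamma> \<longleftrightarrow>
     (\<forall>f\<in>quasimodular_forms m \<xi> \<Gamma>. \<forall>c d. is_quasi_coeffs m \<xi> \<Gamma> f c \<longrightarrow> is_quasi_coeffs m \<xi> \<Gamma> f d
        \<longrightarrow> (\<forall>r\<le>m. \<forall>z\<in>upper_half_plane. c r z = d r z))"

text \<open>It holds as soon as \<open>K(\<gamma>,z)\<close> takes infinitely many values, \<open>\<gamma> \<in> \<Gamma>\<close>, for each \<open>z\<close>.\<close>

lemma quasi_coeffs_determinedI:
  assumes "\<And>z. z \<in> upper_half_plane \<Longrightarrow> infinite ((\<lambda>\<gamma>. fac_K \<gamma> z) ` \<Gamma>)"
  shows "quasi_coeffs_determined m \<xi> \<Gamma>"
  unfolding quasi_coeffs_determined_def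
proof (intro ballI allI impI)
  fix f c d r z
  assume c: "is_quasi_coeffs m \<xi> \<Gamma> f c" and d: "is_quasi_coeffs m \<xi> \<Gamma> f d"
    and r: "r \<le> m" and z: "z \<in> upper_half_plane"
  have "(\<Sum>r\<le>m. (c r z - d r z) * x ^ r) = 0" if "x \<in> (\<lambda>\<gamma>. fac_K \<gamma> z) ` \<Gamma>" for x
  proof -
    from that obtain \<gamma> where \<gamma>: "\<gamma> \<in> \<Gamma>" and x: "x = fac_K \<gamma> z"
      by blast
    have "slash \<xi> f \<gamma> z = (\<Sum>r\<le>m. c r z * x ^ r)" "slash \<xi> f \<gamma> z = (\<Sum>r\<le>m. d r z * x ^ r)"
      using c d z \<gamma> unfolding is_quasi_coeffs_def x by blast+
    then show ?thesis
      by (simp only: left_diff_distrib sum_subtractf diff_self)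
  qed
  then have "(\<lambda>\<gamma>. fac_K \<gamma> z) ` \<Gamma> \<subseteq> {x. (\<Sum>r\<le>m. (c r z - d r z) * x ^ r) = 0}"
    by blast
  then have "infinite {x. (\<Sum>r\<le>m. (c r z - d r z) * x ^ r) = 0}"
    using assms[OF z] infinite_super by blast
  then show "c r z = d r z"
    using polyfun_finite_roots[of "\<lambda>r. c r z - d r z" m] r by auto
qed

text \<open>\<open>\<Q>\<^sup>m\<^sub>\<xi> f\<close>; under \<^const>\<open>quasi_coeffs_determined\<close> its values on the upper half plane do not
  depend on the choice.\<close>

definition quasi_poly ::
  "nat \<Rightarrow> int \<Rightarrow> (real^2^2) set \<Rightarrow> (complex \<Rightarrow> complex) \<Rightarrow> complex \<Rightarrow> complex poly" where
  "quasi_poly m \<xi> \<Gamma> f = (let c = (SOME c. is_quasi_coeffs m \<xi> \<Gamma> f c) in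
     (\<lambda>z. \<Sum>r\<le>m. monom (c r z) r))"

definition coeff_map :: "nat \<Rightarrow> (complex \<Rightarrow> complex poly) \<Rightarrow> complex \<Rightarrow> complex" where
  "coeff_map l F z = coeff (F z) l"

definition finite_index_in :: "(real^2^2) set \<Rightarrow> (real^2^2) set \<Rightarrow> bool" where
  "finite_index_in H K \<longleftrightarrow> finite (rcosets\<^bsub>GL2_pos\<lparr>carrier := K\<rparr>\<^esub> H)"

definition commensurator :: "(real^2^2) set \<Rightarrow> (real^2^2) set" where
  "commensurator \<Gamma> = {g \<in> carrier GL2_pos.
     (let \<Gamma>' = (g <#\<^bsub>GL2_pos\<^esub> \<Gamma>) #>\<^bsub>GL2_pos\<^esub> (inv\<^bsub>GL2_pos\<^esub> g)
      in finite_index_in (\<Gamma>' \<inter> \<Gamma>) \<Gamma> \<and> finite_index_in (\<Gamma>' \<inter> \<Gamma>) \<Gamma>')}"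

text \<open>\<open>R\<close> is a system \<open>{\<alpha>\<^sub>1, \<dots>, \<alpha>\<^sub>s}\<close> with \<open>\<Gamma>\<alpha>\<Gamma> = \<Coprod> \<Gamma>\<alpha>\<^sub>i\<close>. For \<open>\<alpha>\<close> in the commensurator such an
  \<open>R\<close> is automatically finite, so the sums over \<open>R\<close> below are genuine sums.\<close>

definition double_coset_reps :: "(real^2^2) set \<Rightarrow> real^2^2 \<Rightarrow> (real^2^2) set \<Rightarrow> bool" where
  "double_coset_reps \<Gamma> \<alpha> R \<longleftrightarrow>
     (\<Gamma> #>\<^bsub>GL2_pos\<^esub> \<alpha>) <#>\<^bsub>GL2_pos\<^esub> \<Gamma> = (\<Union>\<beta>\<in>R. \<Gamma> #>\<^bsub>GL2_pos\<^esub> \<beta>) \<and>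
     (\<forall>\<beta>\<in>R. \<forall>\<beta>'\<in>R. \<beta> \<noteq> \<beta>' \<longrightarrow> (\<Gamma> #>\<^bsub>GL2_pos\<^esub> \<beta>) \<inter> (\<Gamma> #>\<^bsub>GL2_pos\<^esub> \<beta>') = {})"

text \<open>The Hecke operators \<open>T\<^sub>w(\<alpha>)\<close>, \<open>T\<^sup>P\<^sub>\<xi>(\<alpha>)\<close> and \<open>T\<^sup>Q\<^sub>\<xi>(\<alpha>)\<close>, computed with a system \<open>R\<close> of
  representatives for \<open>\<Gamma>\<alpha>\<Gamma>\<close>.\<close>

definition hecke :: "int \<Rightarrow> (real^2^2) set \<Rightarrow> (complex \<Rightarrow> complex) \<Rightarrow> complex \<Rightarrow> complex" where
  "hecke w R f z = (\<Sum>\<beta>\<in>R. slash w f \<beta> z)"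

definition hecke_P ::
  "int \<Rightarrow> (real^2^2) set \<Rightarrow> (complex \<Rightarrow> complex poly) \<Rightarrow> complex \<Rightarrow> complex poly" where
  "hecke_P \<xi> R F z = (\<Sum>\<beta>\<in>R. slash_poly \<xi> F \<beta> z)"

definition hecke_Q ::
  "nat \<Rightarrow> int \<Rightarrow> (real^2^2) set \<Rightarrow> (real^2^2) set \<Rightarrow> (complex \<Rightarrow> complex) \<Rightarrow> complex \<Rightarrow> complex" where
  "hecke_Q m \<xi> \<Gamma> R f z = (\<Sum>\<beta>\<in>R. coeff_map 0 (slash_poly \<xi> (quasi_poly m \<xi> \<Gamma> f) \<beta>) z)"

end

theory Submission
  imports Defs
begin

text \<open>Evaluating \<open>F \<parallel>\<^sub>\<xi> \<gamma> = F\<close> at \<open>X = K(\<gamma>,z)\<close> shows that the constant term of a quasimodular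
  polynomial \<open>F\<close> is a quasimodular form whose coefficients are those of \<open>F\<close>. Conversely, the
  cocycle rule for \<open>K\<close> shows that the coefficients of \<open>(\<Q>\<^sup>m\<^sub>\<xi> f) \<parallel>\<^sub>\<xi> \<delta>\<close> are coefficients for \<open>f\<close>,
  so they are those of \<open>\<Q>\<^sup>m\<^sub>\<xi> f\<close> once coefficients are determined. Hence \<open>\<Q>\<^sup>m\<^sub>\<xi>\<close> and \<open>S\<^sub>0\<close> are inverse to
  each other, and since \<open>T\<^sup>Q\<^sub>\<xi>(\<alpha>) = S\<^sub>0 \<circ> T\<^sup>P\<^sub>\<xi>(\<alpha>) \<circ> \<Q>\<^sup>m\<^sub>\<xi>\<close>, the first identity follows from
  \<open>T\<^sup>P\<^sub>\<xi>(\<alpha>)\<close> preserving quasimodular polynomials. The second is a comparison of the coefficients of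
  \<open>X\<^sup>m\<close>, where the substitution contributes the factor \<open>(det(\<alpha>)\<^sup>-\<^sup>1 J(\<alpha>,z)\<^sup>2)\<^sup>m\<close>.\<close>

section \<open>Matrices of positive determinant\<close>

lemma matrix_mult_nth_2:
  fixes A B :: "real^2^2"
  shows "(A ** B) $ i $ j = A $ i $ 1 * B $ 1 $ j + A $ i $ 2 * B $ 2 $ j"
  by (simp add: matrix_matrix_mult_def sum_2)

lemma fac_J_nonzero:
  assumes "det \<alpha> > 0" "z \<in> upper_half_plane"
  shows "fac_J \<alpha> z \<noteq> 0"
proof
  assume J: "fac_J \<alpha> z = 0"
  have "Im z > 0" using assms by (simp add: upper_half_plane_def)
  moreover have "\<alpha>$2$1 * Im z = 0" "\<alpha>$2$1 * Re z + \<alpha>$2$2 = 0"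
    using arg_cong[OF J, of Im] arg_cong[OF J, of Re] by (auto simp: fac_J_def)
  ultimately have "\<alpha>$2$1 = 0" "\<alpha>$2$2 = 0" by auto
  then show False using assms by (simp add: det_2)
qed

lemma moebius_in_upper_half_plane:
  assumes "det \<alpha> > 0" "z \<in> upper_half_plane"
  shows "moebius \<alpha> z \<in> upper_half_plane"
proof -
  let ?J = "fac_J \<alpha> z"
  have J: "cmod ?J > 0" using fac_J_nonzero[OF assms] by simp
  have "Im (moebius \<alpha> z) = det \<alpha> * Im z / (cmod ?J)\<^sup>2"
    by (simp add: moebius_def fac_J_def Im_divide det_2 cmod_power2 algebra_simps)
  then show ?thesis using assms J by (simp add: upper_half_plane_def)
qed

lemma fac_J_mult:
  assumes "det \<beta> > 0" "z \<in> upper_half_plane"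
  shows "fac_J (\<alpha> ** \<beta>) z = fac_J \<alpha> (moebius \<beta> z) * fac_J \<beta> z"
  using fac_J_nonzero[OF assms]
  by (simp add: fac_J_def moebius_def matrix_mult_nth_2 field_simps)

lemma moebius_mult:
  assumes "det \<alpha> > 0" "det \<beta> > 0" "z \<in> upper_half_plane"
  shows "moebius (\<alpha> ** \<beta>) z = moebius \<alpha> (moebius \<beta> z)"
proof -
  have J: "fac_J \<beta> z \<noteq> 0" "fac_J \<alpha> (moebius \<beta> z) \<noteq> 0"
    using assms by (simp_all add: fac_J_nonzero moebius_in_upper_half_plane)
  let ?w = "moebius \<beta> z"
  have "?w * fac_J \<beta> z = \<beta>$1$1 * z + \<beta>$1$2"
    using J(1) by (simp add: moebius_def fac_J_def)
  then have "complex_of_real ((\<alpha> ** \<beta>)$1$1) * z + complex_of_real ((\<alpha> ** \<beta>)$1$2)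
      = (\<alpha>$1$1 * ?w + \<alpha>$1$2) * fac_J \<beta> z"
    by (simp add: distrib_right mult.assoc) (simp add: fac_J_def matrix_mult_nth_2 algebra_simps)
  then have "moebius (\<alpha> ** \<beta>) z = (\<alpha>$1$1 * ?w + \<alpha>$1$2) * fac_J \<beta> z / fac_J (\<alpha> ** \<beta>) z"
    by (simp add: moebius_def[of "\<alpha> ** \<beta>"] fac_J_def[of "\<alpha> ** \<beta>"])
  also have "\<dots> = (\<alpha>$1$1 * ?w + \<alpha>$1$2) / fac_J \<alpha> ?w"
    using J(1) by (simp add: fac_J_mult[OF assms(2,3)])
  finally show ?thesis by (simp add: moebius_def[of \<alpha>] fac_J_def)
qed

text \<open>\<open>fac_K\<close> is the logarithmic derivative of \<open>fac_J\<close> in z, and det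
  \<beta> / J(\<beta>,z)^2 is the derivative of z \<mapsto> \<beta>z. The rule is thus the
  logarithmic derivative of \<open>fac_J_mult\<close>, although it is verified here by algebra
  alone.\<close>

lemma fac_K_mult:
  assumes "det \<alpha> > 0" "det \<beta> > 0" "z \<in> upper_half_plane"
  shows "fac_K (\<alpha> ** \<beta>) z = det \<beta> / (fac_J \<beta> z)\<^sup>2 * fac_K \<alpha> (moebius \<beta> z) + fac_K \<beta> z"
proof -
  have J: "fac_J \<beta> z \<noteq> 0" "fac_J \<alpha> (moebius \<beta> z) \<noteq> 0"
    using assms by (simp_all add: fac_J_nonzero moebius_in_upper_half_plane)
  have e: "fac_J \<alpha> (moebius \<beta> z) = fac_J (\<alpha> ** \<beta>) z / fac_J \<beta> z"
    using J(1) by (simp add: fac_J_mult[OF assms(2,3)])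
  have J2: "fac_J (\<alpha> ** \<beta>) z \<noteq> 0" using J e by auto
  \<comment> \<open>The claim multiplied by J(\<beta>,z) J(\<alpha>\<beta>,z): an identity between
    polynomials in z and the matrix entries.\<close>
  have *: "complex_of_real ((\<alpha> ** \<beta>)$2$1) * fac_J \<beta> z
      = complex_of_real (det \<beta>) * \<alpha>$2$1 + \<beta>$2$1 * fac_J (\<alpha> ** \<beta>) z"
    by (simp add: fac_J_def matrix_mult_nth_2 det_2 algebra_simps)
  have "fac_K (\<alpha> ** \<beta>) z = complex_of_real ((\<alpha> ** \<beta>)$2$1) * fac_J \<beta> z
      / (fac_J \<beta> z * fac_J (\<alpha> ** \<beta>) z)"
    using J by (simp add: fac_K_def)
  also have "\<dots> = det \<beta> / (fac_J \<beta> z)\<^sup>2 * fac_K \<alpha> (moebius \<beta> z) + fac_K \<beta> z"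
    unfolding * using J(1) J2 by (simp add: fac_K_def e field_simps power2_eq_square)
  finally show ?thesis .
qed

section \<open>The slash actions\<close>

lemma slash_mult:
  assumes "det \<alpha> > 0" "det \<beta> > 0" "z \<in> upper_half_plane"
  shows "slash w f (\<alpha> ** \<beta>) z = slash w (slash w f \<alpha>) \<beta> z"
  using assms
  by (simp add: slash_def det_mul powr_mult moebius_mult fac_J_mult power_int_mult_distrib)

text \<open>The substituted linear polynomials compose just as the matrices multiply
  (\<open>L\<close>), which is \<open>fac_K_mult\<close> combined with \<open>fac_J_mult\<close>.
  What remains is multiplicativity of the scalar factors.\<close>

lemma slash_poly_mult:
  assumes "det \<alpha> > 0" "det \<beta> > 0" "z \<in> upper_half_plane"
  shows "slash_poly w F (\<alpha> ** \<beta>) z = slash_poly w (slash_poly w F \<alpha>) \<beta> z"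
proof -
  let ?L = "\<lambda>\<alpha> z. smult (inverse (complex_of_real (det \<alpha>)) * (fac_J \<alpha> z)\<^sup>2) [:- fac_K \<alpha> z, 1:]"
  have J: "fac_J \<beta> z \<noteq> 0" using assms by (simp add: fac_J_nonzero)
  have L: "?L (\<alpha> ** \<beta>) z = pcompose (?L \<alpha> (moebius \<beta> z)) (?L \<beta> z)"
    using assms J
    by (simp add: pcompose_pCons fac_K_mult fac_J_mult det_mul field_simps power2_eq_square)
  have c: "pcompose (smult a (pcompose p q)) r = smult a (pcompose p (pcompose q r))"
    for a and p q r :: "complex poly"
    by (simp add: pcompose_smult pcompose_assoc)
  show ?thesis
    unfolding slash_poly_def L moebius_mult[OF assms] c smult_smult
    by (rule arg_cong2[of _ _ _ _ smult])
      (simp_all add: det_mul powr_mult fac_J_mult[OF assms(2,3)] power_int_mult_distrib)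
qed

lemma slash_poly_cong:
  assumes "F (moebius \<alpha> z) = G (moebius \<alpha> z)"
  shows "slash_poly w F \<alpha> z = slash_poly w G \<alpha> z"
  using assms by (simp add: slash_poly_def)

lemma slash_poly_sum:
  "slash_poly w (\<lambda>z. \<Sum>i\<in>I. F i z) \<alpha> z = (\<Sum>i\<in>I. slash_poly w (F i) \<alpha> z)"
  by (induction I rule: infinite_finite_induct)
    (simp_all add: slash_poly_def pcompose_add smult_add_right)

text \<open>With \<alpha> unrestricted the scalar in front of the linear polynomial may vanish, so
  that polynomial is only known to have degree at most 1; this still cannot raise the
  degree.\<close>

lemma degree_slash_poly_le: "degree (slash_poly w F \<alpha> z) \<le> degree (F (moebius \<alpha> z))"
proof -
  have "degree (smult c [:a, 1:]) \<le> 1" for a c :: complex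
    using degree_smult_le[of c "[:a, 1:]"] by simp
  then have "degree (pcompose p (smult c [:a, 1:])) \<le> degree p" for p and a c :: complex
    using mult_le_mono2[of _ 1 "degree p"] by (simp add: degree_pcompose del: smult_pCons)
  then show ?thesis
    unfolding slash_poly_def using degree_smult_le le_trans by blast
qed

section \<open>Coefficients and values under a linear substitution\<close>

lemma poly_conv_sum:
  fixes p :: "complex poly"
  assumes "degree p \<le> m"
  shows "poly p x = (\<Sum>r\<le>m. coeff p r * x ^ r)"
  using arg_cong[OF poly_as_sum_of_monoms'[OF assms], of "\<lambda>p. poly p x"]
  by (simp add: poly_sum poly_monom)

text \<open>The range of summation depends on the bound m and not on the degree of p. When p varies
  with z, every coefficient of the composite is then one fixed finite sum, as the proof of
  holomorphy requires.\<close>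

lemma pcompose_conv_sum:
  fixes p q :: "complex poly"
  assumes "degree p \<le> m"
  shows "pcompose p q = (\<Sum>k\<le>m. smult (coeff p k) (q ^ k))"
proof -
  have "poly (pcompose p q) x = poly (\<Sum>k\<le>m. smult (coeff p k) (q ^ k)) x" for x
    by (simp add: poly_pcompose poly_sum poly_conv_sum[OF assms])
  then show ?thesis by (simp add: poly_eq_poly_eq_iff[symmetric] fun_eq_iff)
qed

text \<open>If p has degree exactly m this compares leading coefficients; if the degree is smaller,
  both sides are 0, because a linear substitution with b \<noteq> 0 preserves the degree.\<close>

lemma coeff_pcompose_linear_top:
  fixes p :: "complex poly"
  assumes "degree p \<le> m" "b \<noteq> 0"
  shows "coeff (pcompose p [:a, b:]) m = coeff p m * b ^ m"
proof (cases "degree p = m")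
  case True
  have d: "degree [:a, b:] = 1" using assms by simp
  have "lead_coeff (pcompose p [:a, b:]) = lead_coeff p * b ^ degree p"
    using d by (simp add: lead_coeff_comp)
  then show ?thesis using True d by (simp add: degree_pcompose)
next
  case False
  then show ?thesis using assms by (simp add: coeff_eq_0 degree_pcompose)
qed

text \<open>The m-th power of det(\<alpha>)^-1 J^2 merges with det(\<alpha>)^(w/2) J^(-w); the
  exponents w/2 - m and 2m - w that result are those of weight w - 2m.\<close>

lemma coeff_slash_poly_top:
  assumes "det \<alpha> > 0" "z \<in> upper_half_plane" "degree (F (moebius \<alpha> z)) \<le> m"
  shows "coeff (slash_poly w F \<alpha> z) m = slash (w - 2 * int m) (coeff_map m F) \<alpha> z"
proof -
  let ?J = "fac_J \<alpha> z"
  have J: "?J \<noteq> 0" using assms by (simp add: fac_J_nonzero)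
  have "of_int (w - 2 * int m) / 2 = (of_int w / 2 - real m :: real)"
    by (simp add: field_simps)
  then have d: "det \<alpha> powr (of_int (w - 2 * int m) / 2) = det \<alpha> powr (of_int w / 2) * inverse (det \<alpha>) ^ m"
    by (simp only: powr_diff powr_realpow[OF assms(1)] divide_inverse power_inverse)
  have "?J powi (- (w - 2 * int m)) = ?J powi (- w + int (2 * m))"
    by (simp add: algebra_simps)
  also have "\<dots> = ?J powi (- w) * ?J powi (int (2 * m))"
    using J by (intro power_int_add) simp
  finally have j: "?J powi (- (w - 2 * int m)) = ?J powi (- w) * (?J\<^sup>2) ^ m"
    by (simp only: power_int_of_nat power_mult)
  have q: "inverse (complex_of_real (det \<alpha>)) * ?J\<^sup>2 \<noteq> 0"
    using assms(1) J by simp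
  have "coeff (pcompose (F (moebius \<alpha> z)) (smult c [:a, 1:])) m = coeff (F (moebius \<alpha> z)) m * c ^ m"
    if "c \<noteq> 0" for a c
    using coeff_pcompose_linear_top[OF assms(3) that] by simp
  from this[OF q] show ?thesis
    unfolding slash_poly_def slash_def coeff_map_def d j
    by (simp add: power_mult_distrib mult_ac del: smult_pCons)
qed

text \<open>K(\<alpha>,z) is a root of the substituted linear polynomial, so only the constant term
  of F survives the evaluation.\<close>

lemma poly_slash_poly_fac_K:
  "poly (slash_poly w F \<alpha> z) (fac_K \<alpha> z) = slash w (coeff_map 0 F) \<alpha> z"
  by (simp add: slash_poly_def slash_def coeff_map_def poly_pcompose poly_0_coeff_0)

section \<open>Holomorphy\<close>

lemma coeff_mult_holomorphic:
  fixes p q :: "complex \<Rightarrow> complex poly"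
  assumes "\<And>r. (\<lambda>z. coeff (p z) r) holomorphic_on S" "\<And>r. (\<lambda>z. coeff (q z) r) holomorphic_on S"
  shows "(\<lambda>z. coeff (p z * q z) r) holomorphic_on S"
  unfolding coeff_mult by (intro holomorphic_intros assms)

lemma coeff_power_holomorphic:
  fixes p :: "complex \<Rightarrow> complex poly"
  assumes "\<And>r. (\<lambda>z. coeff (p z) r) holomorphic_on S"
  shows "(\<lambda>z. coeff (p z ^ k) r) holomorphic_on S"
proof (induction k arbitrary: r)
  case 0
  then show ?case by simp
next
  case (Suc k)
  then show ?case using assms by (simp add: coeff_mult_holomorphic)
qed

lemma fac_J_holomorphic: "fac_J \<alpha> holomorphic_on S"
  unfolding fac_J_def [abs_def] by (intro holomorphic_intros)

lemma fac_K_holomorphic: "det \<alpha> > 0 \<Longrightarrow> fac_K \<alpha> holomorphic_on upper_half_plane"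
  unfolding fac_K_def [abs_def]
  by (intro holomorphic_intros fac_J_holomorphic) (auto dest: fac_J_nonzero)

lemma moebius_holomorphic: "det \<alpha> > 0 \<Longrightarrow> moebius \<alpha> holomorphic_on upper_half_plane"
  unfolding moebius_def [abs_def] fac_J_def [symmetric]
  by (intro holomorphic_intros fac_J_holomorphic) (auto dest: fac_J_nonzero)

lemma holomorphic_compose_moebius:
  assumes "f holomorphic_on upper_half_plane" "det \<alpha> > 0"
  shows "(\<lambda>z. f (moebius \<alpha> z)) holomorphic_on upper_half_plane"
  using holomorphic_on_compose_gen[OF moebius_holomorphic[OF assms(2)] assms(1)]
    moebius_in_upper_half_plane[OF assms(2)] by (auto simp: o_def)

lemma hol_polys_slash_poly:
  assumes F: "F \<in> hol_polys m" and \<alpha>: "det \<alpha> > 0"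
  shows "slash_poly w F \<alpha> \<in> hol_polys m"
proof -
  have deg: "degree (F (moebius \<alpha> z)) \<le> m" if "z \<in> upper_half_plane" for z
    using that F moebius_in_upper_half_plane[OF \<alpha>] by (auto simp: hol_polys_def)
  have hol: "(\<lambda>z. coeff (slash_poly w F \<alpha> z) r) holomorphic_on upper_half_plane" for r
  proof -
    let ?L = "\<lambda>z. smult (inverse (complex_of_real (det \<alpha>)) * (fac_J \<alpha> z)\<^sup>2) [:- fac_K \<alpha> z, 1:]"
    have L: "(\<lambda>z. coeff (?L z) r) holomorphic_on upper_half_plane" for r
      \<comment> \<open>The cases are the coefficients 0 and 1 and the higher ones, which
        vanish.\<close>
      by (cases r; cases "r - 1")
        (auto intro!: holomorphic_intros fac_J_holomorphic fac_K_holomorphic \<alpha>)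
    \<comment> \<open>The coefficient of X^r expanded by \<open>pcompose_conv_sum\<close>. It agrees
      with the original one on the half plane, where the degree bound \<open>deg\<close> is
      available.\<close>
    have "(\<lambda>z. complex_of_real (det \<alpha> powr (of_int w / 2)) * fac_J \<alpha> z powi (- w)
        * (\<Sum>k\<le>m. coeff (F (moebius \<alpha> z)) k * coeff (?L z ^ k) r)) holomorphic_on upper_half_plane"
      by (intro holomorphic_intros fac_J_holomorphic holomorphic_compose_moebius[OF _ \<alpha>]
          coeff_power_holomorphic L)
        (use F \<alpha> in \<open>auto simp: hol_polys_def dest: fac_J_nonzero\<close>)
    then show ?thesis
      by (rule holomorphic_transform)
        (simp add: slash_poly_def pcompose_conv_sum[OF deg] coeff_sum del: smult_pCons)
  qed
  have "degree (slash_poly w F \<alpha> z) \<le> m" if "z \<in> upper_half_plane" for z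
    using degree_slash_poly_le deg[OF that] by (rule le_trans)
  then show ?thesis using hol by (simp add: hol_polys_def)
qed

lemma hol_polys_sum:
  assumes "\<And>i. i \<in> I \<Longrightarrow> F i \<in> hol_polys m"
  shows "(\<lambda>z. \<Sum>i\<in>I. F i z) \<in> hol_polys m"
proof (cases "finite I")
  case True
  then show ?thesis using assms
    by (auto simp: hol_polys_def coeff_sum intro!: holomorphic_intros degree_sum_le)
next
  case False
  \<comment> \<open>A sum over an infinite set is 0 by convention, and the zero polynomial
    qualifies.\<close>
  then show ?thesis by (simp add: hol_polys_def)
qed

section \<open>Cosets\<close>

lemma mem_r_coset_GL2_pos: "x \<in> \<Gamma> #>\<^bsub>GL2_pos\<^esub> \<beta> \<longleftrightarrow> (\<exists>\<gamma>\<in>\<Gamma>. x = \<gamma> ** \<beta>)"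
  by (auto simp: r_coset_def GL2_pos_def)

lemma mem_set_mult_GL2_pos: "x \<in> A <#>\<^bsub>GL2_pos\<^esub> B \<longleftrightarrow> (\<exists>a\<in>A. \<exists>b\<in>B. x = a ** b)"
  by (auto simp: set_mult_def GL2_pos_def)

lemma SL2_left_inverse:
  fixes A :: "real^2^2"
  assumes "det A = 1"
  shows "\<exists>B. det B = 1 \<and> B ** A = mat 1"
proof -
  obtain B where B: "B ** A = mat 1"
    using assms invertible_det_nz[of A] by (auto simp: invertible_def)
  then have "det B * det A = 1" by (simp add: det_mul[symmetric])
  then show ?thesis using B assms by auto
qed

lemma group_SL2: "group SL2"
  by (rule groupI) (auto simp: SL2_def det_mul matrix_mul_assoc SL2_left_inverse)

text \<open>Membership facts are restated through \<open>**\<close> and \<open>mat 1\<close>, so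
  that group laws taken from \<open>SL2\<close> can be used on cosets formed in
  \<open>GL2_pos\<close>.\<close>

locale SL2_subgroup =
  fixes \<Gamma> :: "(real^2^2) set"
  assumes subgroup: "subgroup \<Gamma> SL2"
begin

lemma det_eq_1: "\<gamma> \<in> \<Gamma> \<Longrightarrow> det \<gamma> = 1"
  using subgroup.mem_carrier[OF subgroup] by (simp add: SL2_def)

lemma one_mem: "mat 1 \<in> \<Gamma>"
  using subgroup.one_closed[OF subgroup] by (simp add: SL2_def)

lemma mult_mem: "\<gamma> \<in> \<Gamma> \<Longrightarrow> \<delta> \<in> \<Gamma> \<Longrightarrow> \<gamma> ** \<delta> \<in> \<Gamma>"
  using subgroup.m_closed[OF subgroup] by (simp add: SL2_def)

lemma ex_inverse:
  assumes "\<gamma> \<in> \<Gamma>"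
  obtains \<delta> where "\<delta> \<in> \<Gamma>" "\<delta> ** \<gamma> = mat 1" "\<gamma> ** \<delta> = mat 1"
proof
  show "inv\<^bsub>SL2\<^esub> \<gamma> \<in> \<Gamma>" using subgroup.m_inv_closed[OF subgroup assms] .
  have "\<gamma> \<in> carrier SL2" using subgroup.mem_carrier[OF subgroup assms] .
  then show "inv\<^bsub>SL2\<^esub> \<gamma> ** \<gamma> = mat 1" "\<gamma> ** inv\<^bsub>SL2\<^esub> \<gamma> = mat 1"
    using group.l_inv[OF group_SL2] group.r_inv[OF group_SL2] by (auto simp: SL2_def)
qed

section \<open>Double cosets and change of representatives\<close>

lemma mem_double_coset:
  "x \<in> (\<Gamma> #>\<^bsub>GL2_pos\<^esub> \<alpha>) <#>\<^bsub>GL2_pos\<^esub> \<Gamma> \<longleftrightarrow> (\<exists>\<gamma>\<in>\<Gamma>. \<exists>\<delta>\<in>\<Gamma>. x = \<gamma> ** \<alpha> ** \<delta>)"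
  unfolding mem_set_mult_GL2_pos by (simp add: Bex_def mem_r_coset_GL2_pos) blast

lemma mem_double_coset_mult_right:
  assumes "x \<in> (\<Gamma> #>\<^bsub>GL2_pos\<^esub> \<alpha>) <#>\<^bsub>GL2_pos\<^esub> \<Gamma>" "\<gamma> \<in> \<Gamma>"
  shows "x ** \<gamma> \<in> (\<Gamma> #>\<^bsub>GL2_pos\<^esub> \<alpha>) <#>\<^bsub>GL2_pos\<^esub> \<Gamma>"
proof -
  obtain \<delta> \<epsilon> where x: "\<delta> \<in> \<Gamma>" "\<epsilon> \<in> \<Gamma>" "x = \<delta> ** \<alpha> ** \<epsilon>"
    using assms(1) unfolding mem_double_coset by blast
  then have "x ** \<gamma> = \<delta> ** \<alpha> ** (\<epsilon> ** \<gamma>)" by (simp add: matrix_mul_assoc)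
  then show ?thesis unfolding mem_double_coset using x mult_mem[OF x(2) assms(2)] by blast
qed

lemma ex_rep:
  assumes "double_coset_reps \<Gamma> \<alpha> R" "x \<in> (\<Gamma> #>\<^bsub>GL2_pos\<^esub> \<alpha>) <#>\<^bsub>GL2_pos\<^esub> \<Gamma>"
  shows "\<exists>\<beta>\<in>R. \<exists>\<gamma>\<in>\<Gamma>. x = \<gamma> ** \<beta>"
  using assms by (auto simp: double_coset_reps_def mem_r_coset_GL2_pos)

lemma rep_mult_mem_double_coset:
  assumes "double_coset_reps \<Gamma> \<alpha> R" "\<beta> \<in> R" "\<gamma> \<in> \<Gamma>"
  shows "\<gamma> ** \<beta> \<in> (\<Gamma> #>\<^bsub>GL2_pos\<^esub> \<alpha>) <#>\<^bsub>GL2_pos\<^esub> \<Gamma>"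
  using assms by (auto simp: double_coset_reps_def mem_r_coset_GL2_pos)

lemma rep_mem_double_coset:
  assumes "double_coset_reps \<Gamma> \<alpha> R" "\<beta> \<in> R"
  shows "\<beta> \<in> (\<Gamma> #>\<^bsub>GL2_pos\<^esub> \<alpha>) <#>\<^bsub>GL2_pos\<^esub> \<Gamma>"
  using rep_mult_mem_double_coset[OF assms one_mem] by simp

lemma det_rep:
  assumes "double_coset_reps \<Gamma> \<alpha> R" "\<beta> \<in> R"
  shows "det \<beta> = det \<alpha>"
  using rep_mem_double_coset[OF assms] by (auto simp: mem_double_coset det_mul det_eq_1)

lemma rep_unique:
  assumes R: "double_coset_reps \<Gamma> \<alpha> R" "\<beta> \<in> R" "\<beta>' \<in> R"
    and \<gamma>: "\<gamma> \<in> \<Gamma>" "\<delta> \<in> \<Gamma>" "\<gamma> ** \<beta> = \<delta> ** \<beta>'"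
  shows "\<beta> = \<beta>'"
  using R \<gamma> unfolding double_coset_reps_def disjoint_iff mem_r_coset_GL2_pos by blast

lemma mult_left_cancel:
  assumes "\<gamma> \<in> \<Gamma>" "x = \<gamma> ** y"
  shows "\<exists>\<delta>\<in>\<Gamma>. y = \<delta> ** x"
proof -
  obtain \<delta> where "\<delta> \<in> \<Gamma>" "\<delta> ** \<gamma> = mat 1" using ex_inverse[OF assms(1)] by blast
  then show ?thesis using assms(2) by (auto simp: matrix_mul_assoc intro!: bexI[of _ \<delta>])
qed

text \<open>Sending each element of R to the element of R' in the same coset is a bijection, and g
  ignores the left factor from \<Gamma>. Invariance is demanded only at elements of R', whose
  determinant is that of \<alpha>, so the slash rules apply there.\<close>

lemma sum_double_coset_reps:
  fixes g :: "real^2^2 \<Rightarrow> 'b::comm_monoid_add"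
  assumes R: "double_coset_reps \<Gamma> \<alpha> R" and R': "double_coset_reps \<Gamma> \<alpha> R'"
    and g: "\<And>\<gamma> \<beta>. \<gamma> \<in> \<Gamma> \<Longrightarrow> \<beta> \<in> R' \<Longrightarrow> g (\<gamma> ** \<beta>) = g \<beta>"
  shows "sum g R = sum g R'"
proof -
  have "\<forall>\<beta>\<in>R. \<exists>\<beta>'. \<beta>' \<in> R' \<and> (\<exists>\<gamma>\<in>\<Gamma>. \<beta> = \<gamma> ** \<beta>')"
    using ex_rep[OF R'] rep_mem_double_coset[OF R] by blast
  then obtain \<phi> where \<phi>: "\<And>\<beta>. \<beta> \<in> R \<Longrightarrow> \<phi> \<beta> \<in> R'"
      "\<And>\<beta>. \<beta> \<in> R \<Longrightarrow> \<exists>\<gamma>\<in>\<Gamma>. \<beta> = \<gamma> ** \<phi> \<beta>"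
    using bchoice[of R "\<lambda>\<beta> \<beta>'. \<beta>' \<in> R' \<and> (\<exists>\<gamma>\<in>\<Gamma>. \<beta> = \<gamma> ** \<beta>')"] by auto
  have "bij_betw \<phi> R R'"
  proof (rule bij_betwI')
    fix \<beta> \<beta>' assume *: "\<beta> \<in> R" "\<beta>' \<in> R"
    obtain \<gamma> where \<gamma>: "\<gamma> \<in> \<Gamma>" "\<phi> \<beta> = \<gamma> ** \<beta>" using \<phi>(2)[OF *(1)] mult_left_cancel by blast
    obtain \<delta> where \<delta>: "\<delta> \<in> \<Gamma>" "\<phi> \<beta>' = \<delta> ** \<beta>'" using \<phi>(2)[OF *(2)] mult_left_cancel by blast
    show "\<phi> \<beta> = \<phi> \<beta>' \<longleftrightarrow> \<beta> = \<beta>'"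
      using rep_unique[OF R * \<gamma>(1) \<delta>(1)] \<gamma>(2) \<delta>(2) by auto
  next
    show "\<phi> \<beta> \<in> R'" if "\<beta> \<in> R" for \<beta> using \<phi>(1)[OF that] .
  next
    \<comment> \<open>Surjectivity: if \<beta> in R represents the coset of \<beta>', then \<phi>
      \<beta> and \<beta>' are elements of R' in one coset, hence equal.\<close>
    fix \<beta>' assume *: "\<beta>' \<in> R'"
    obtain \<beta> \<gamma> where \<beta>: "\<beta> \<in> R" "\<gamma> \<in> \<Gamma>" "\<beta>' = \<gamma> ** \<beta>"
      using ex_rep[OF R rep_mem_double_coset[OF R' *]] by blast
    obtain \<delta> where \<delta>: "\<delta> \<in> \<Gamma>" "\<beta> = \<delta> ** \<phi> \<beta>" using \<phi>(2)[OF \<beta>(1)] by blast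
    have "\<beta>' = (\<gamma> ** \<delta>) ** \<phi> \<beta>"
      using \<beta>(3) arg_cong[OF \<delta>(2), of "(**) \<gamma>"] by (simp add: matrix_mul_assoc)
    then have "\<beta>' = \<phi> \<beta>"
      using rep_unique[OF R' * \<phi>(1)[OF \<beta>(1)] one_mem mult_mem[OF \<beta>(2) \<delta>(1)]] by simp
    then show "\<exists>\<beta>\<in>R. \<beta>' = \<phi> \<beta>" using \<beta>(1) by blast
  qed
  then have "sum g R' = (\<Sum>\<beta>\<in>R. g (\<phi> \<beta>))" by (rule sum.reindex_bij_betw[symmetric])
  also have "\<dots> = sum g R"
  proof (rule sum.cong)
    fix \<beta> assume \<beta>: "\<beta> \<in> R"
    then obtain \<gamma> where "\<gamma> \<in> \<Gamma>" "\<beta> = \<gamma> ** \<phi> \<beta>" using \<phi>(2) by blast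
    then show "g (\<phi> \<beta>) = g \<beta>" using g[OF _ \<phi>(1)[OF \<beta>], of \<gamma>] by simp
  qed simp
  finally show ?thesis by simp
qed

text \<open>Right multiplication by \<gamma> permutes the cosets that make up
  \<Gamma>\<alpha>\<Gamma>, with inverse given by \<gamma>^-1. Injectivity is recorded so that sums
  over the image can be reindexed.\<close>

lemma double_coset_reps_mult_right:
  assumes R: "double_coset_reps \<Gamma> \<alpha> R" and \<gamma>: "\<gamma> \<in> \<Gamma>"
  shows "inj_on (\<lambda>\<beta>. \<beta> ** \<gamma>) R" "double_coset_reps \<Gamma> \<alpha> ((\<lambda>\<beta>. \<beta> ** \<gamma>) ` R)"
proof -
  obtain \<delta> where \<delta>: "\<delta> \<in> \<Gamma>" "\<delta> ** \<gamma> = mat 1" "\<gamma> ** \<delta> = mat 1" using ex_inverse[OF \<gamma>] .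
  have c: "(x ** \<gamma>) ** \<delta> = x" "(x ** \<delta>) ** \<gamma> = x" for x
    using \<delta> by (simp_all add: matrix_mul_assoc[symmetric])
  show "inj_on (\<lambda>\<beta>. \<beta> ** \<gamma>) R" by (rule inj_on_inverseI[of _ "\<lambda>x. x ** \<delta>"]) (rule c(1))
  show "double_coset_reps \<Gamma> \<alpha> ((\<lambda>\<beta>. \<beta> ** \<gamma>) ` R)"
    unfolding double_coset_reps_def
  proof (rule conjI, rule Set.set_eqI, goal_cases)
    case (1 x)
    let ?D = "(\<Gamma> #>\<^bsub>GL2_pos\<^esub> \<alpha>) <#>\<^bsub>GL2_pos\<^esub> \<Gamma>"
    have "x \<in> ?D \<longleftrightarrow> x ** \<delta> \<in> ?D"
      using mem_double_coset_mult_right[OF _ \<delta>(1), of x]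
        mem_double_coset_mult_right[OF _ \<gamma>, of "x ** \<delta>"] unfolding c(2) by blast
    also have "\<dots> \<longleftrightarrow> (\<exists>\<beta>\<in>R. \<exists>\<epsilon>\<in>\<Gamma>. x ** \<delta> = \<epsilon> ** \<beta>)"
      using ex_rep[OF R] rep_mult_mem_double_coset[OF R] by auto
    also have "\<dots> \<longleftrightarrow> (\<exists>\<beta>\<in>R. \<exists>\<epsilon>\<in>\<Gamma>. x = \<epsilon> ** (\<beta> ** \<gamma>))"
    proof -
      have "x ** \<delta> = y \<longleftrightarrow> x = y ** \<gamma>" for y using c(1)[of y] c(2)[of x] by auto
      then show ?thesis by (simp add: matrix_mul_assoc)
    qed
    finally show ?case
      by (auto simp: mem_r_coset_GL2_pos)
  next
    case 2
    show ?case
    proof (intro ballI impI)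
      fix b b' assume b: "b \<in> (\<lambda>\<beta>. \<beta> ** \<gamma>) ` R" "b' \<in> (\<lambda>\<beta>. \<beta> ** \<gamma>) ` R" "b \<noteq> b'"
      then obtain \<beta> \<beta>' where \<beta>: "\<beta> \<in> R" "\<beta>' \<in> R" "b = \<beta> ** \<gamma>" "b' = \<beta>' ** \<gamma>" by blast
      show "(\<Gamma> #>\<^bsub>GL2_pos\<^esub> b) \<inter> (\<Gamma> #>\<^bsub>GL2_pos\<^esub> b') = {}"
      proof (rule equals0I)
        fix x assume "x \<in> (\<Gamma> #>\<^bsub>GL2_pos\<^esub> b) \<inter> (\<Gamma> #>\<^bsub>GL2_pos\<^esub> b')"
        then obtain \<epsilon> \<epsilon>' where e: "\<epsilon> \<in> \<Gamma>" "\<epsilon>' \<in> \<Gamma>" "\<epsilon> ** b = \<epsilon>' ** b'"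
          unfolding Int_iff mem_r_coset_GL2_pos by auto
        have "(\<epsilon> ** \<beta>) ** \<gamma> = (\<epsilon>' ** \<beta>') ** \<gamma>"
          using e(3) \<beta>(3,4) by (simp add: matrix_mul_assoc)
        then have "\<epsilon> ** \<beta> = \<epsilon>' ** \<beta>'" using c(1) by metis
        then show False using rep_unique[OF R \<beta>(1,2) e(1,2)] \<beta> b(3) by simp
      qed
    qed
  qed
qed

section \<open>Hecke operators\<close>

text \<open>Invariance of F under \<Gamma> makes the summand depend only on the coset
  \<Gamma>\<beta>.\<close>

lemma hecke_P_indep:
  assumes F: "F \<in> quasimodular_polys m w \<Gamma>" and \<alpha>: "det \<alpha> > 0"
    and R: "double_coset_reps \<Gamma> \<alpha> R" and R': "double_coset_reps \<Gamma> \<alpha> R'"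
    and z: "z \<in> upper_half_plane"
  shows "hecke_P w R F z = hecke_P w R' F z"
  unfolding hecke_P_def
proof (rule sum_double_coset_reps[OF R R'])
  fix \<gamma> \<beta> assume \<gamma>: "\<gamma> \<in> \<Gamma>" and \<beta>: "\<beta> \<in> R'"
  have d: "det \<gamma> > 0" "det \<beta> > 0" using det_eq_1[OF \<gamma>] det_rep[OF R' \<beta>] \<alpha> by auto
  have "slash_poly w F (\<gamma> ** \<beta>) z = slash_poly w (slash_poly w F \<gamma>) \<beta> z"
    by (rule slash_poly_mult[OF d z])
  also have "\<dots> = slash_poly w F \<beta> z"
    using F \<gamma> moebius_in_upper_half_plane[OF d(2) z]
    by (intro slash_poly_cong) (auto simp: quasimodular_polys_def)
  finally show "slash_poly w F (\<gamma> ** \<beta>) z = slash_poly w F \<beta> z" .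
qed

text \<open>Slashing the sum by \<gamma> replaces R by R\<gamma>, which is again a system of
  representatives, so independence of the system gives invariance.\<close>

lemma hecke_P_quasimodular:
  assumes F: "F \<in> quasimodular_polys m w \<Gamma>" and \<alpha>: "det \<alpha> > 0"
    and R: "double_coset_reps \<Gamma> \<alpha> R"
  shows "hecke_P w R F \<in> quasimodular_polys m w \<Gamma>"
  unfolding quasimodular_polys_def
proof (intro CollectI conjI ballI)
  have "F \<in> hol_polys m" using F by (simp add: quasimodular_polys_def)
  then show "hecke_P w R F \<in> hol_polys m"
    unfolding hecke_P_def [abs_def]
    using det_rep[OF R] \<alpha> by (intro hol_polys_sum) (auto intro!: hol_polys_slash_poly)
next
  fix \<gamma> z assume \<gamma>: "\<gamma> \<in> \<Gamma>" and z: "z \<in> upper_half_plane"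
  have "slash_poly w (hecke_P w R F) \<gamma> z = (\<Sum>\<beta>\<in>R. slash_poly w (slash_poly w F \<beta>) \<gamma> z)"
    unfolding hecke_P_def [abs_def] by (rule slash_poly_sum)
  also have "\<dots> = (\<Sum>\<beta>\<in>R. slash_poly w F (\<beta> ** \<gamma>) z)"
    using det_rep[OF R] \<alpha> z det_eq_1[OF \<gamma>] by (intro sum.cong) (auto simp: slash_poly_mult)
  also have "\<dots> = hecke_P w ((\<lambda>\<beta>. \<beta> ** \<gamma>) ` R) F z"
    unfolding hecke_P_def by (simp add: sum.reindex double_coset_reps_mult_right(1)[OF R \<gamma>])
  also have "\<dots> = hecke_P w R F z"
    by (rule hecke_P_indep[OF F \<alpha> double_coset_reps_mult_right(2)[OF R \<gamma>] R z])
  finally show "slash_poly w (hecke_P w R F) \<gamma> z = hecke_P w R F z" .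
qed

text \<open>Compare the coefficients of X^m in the invariance equation for F.\<close>

lemma coeff_map_top_modular:
  assumes F: "F \<in> quasimodular_polys m w \<Gamma>"
  shows "coeff_map m F \<in> modular_forms (w - 2 * int m) \<Gamma>"
  unfolding modular_forms_def
proof (intro CollectI conjI ballI)
  show "coeff_map m F holomorphic_on upper_half_plane"
    using F by (simp add: coeff_map_def [abs_def] quasimodular_polys_def hol_polys_def)
next
  fix \<gamma> z assume \<gamma>: "\<gamma> \<in> \<Gamma>" and z: "z \<in> upper_half_plane"
  have d: "det \<gamma> > 0" using det_eq_1[OF \<gamma>] by simp
  have "degree (F (moebius \<gamma> z)) \<le> m"
    using F moebius_in_upper_half_plane[OF d z] by (auto simp: quasimodular_polys_def hol_polys_def)
  then have "slash (w - 2 * int m) (coeff_map m F) \<gamma> z = coeff (slash_poly w F \<gamma> z) m"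
    by (simp add: coeff_slash_poly_top[OF d z])
  then show "slash (w - 2 * int m) (coeff_map m F) \<gamma> z = coeff_map m F z"
    using F \<gamma> z by (simp add: quasimodular_polys_def coeff_map_def)
qed

lemma coeff_map_top_hecke_P:
  assumes F: "F \<in> quasimodular_polys m w \<Gamma>" and \<alpha>: "det \<alpha> > 0"
    and R: "double_coset_reps \<Gamma> \<alpha> R" and z: "z \<in> upper_half_plane"
  shows "coeff_map m (hecke_P w R F) z = hecke (w - 2 * int m) R (coeff_map m F) z"
proof -
  have "coeff (slash_poly w F \<beta> z) m = slash (w - 2 * int m) (coeff_map m F) \<beta> z" if "\<beta> \<in> R" for \<beta>
  proof -
    have d: "det \<beta> > 0" using det_rep[OF R that] \<alpha> by simp
    have "degree (F (moebius \<beta> z)) \<le> m"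
      using F moebius_in_upper_half_plane[OF d z]
      by (auto simp: quasimodular_polys_def hol_polys_def)
    then show ?thesis by (rule coeff_slash_poly_top[OF d z])
  qed
  then show ?thesis by (simp add: coeff_map_def[of m "hecke_P w R F"] hecke_P_def hecke_def coeff_sum)
qed

section \<open>Quasimodular forms and quasimodular polynomials\<close>

lemma is_quasi_coeffs_coeff_map:
  assumes F: "F \<in> quasimodular_polys m w \<Gamma>"
  shows "is_quasi_coeffs m w \<Gamma> (coeff_map 0 F) (\<lambda>r. coeff_map r F)"
  unfolding is_quasi_coeffs_def
proof (intro conjI allI impI ballI)
  fix r
  show "coeff_map r F holomorphic_on upper_half_plane"
    using F by (simp add: coeff_map_def [abs_def] quasimodular_polys_def hol_polys_def)
next
  fix \<gamma> z assume \<gamma>: "\<gamma> \<in> \<Gamma>" and z: "z \<in> upper_half_plane"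
  have "slash w (coeff_map 0 F) \<gamma> z = poly (F z) (fac_K \<gamma> z)"
    using F \<gamma> z by (simp add: poly_slash_poly_fac_K[symmetric] quasimodular_polys_def)
  then show "slash w (coeff_map 0 F) \<gamma> z = (\<Sum>r\<le>m. coeff_map r F z * fac_K \<gamma> z ^ r)"
    using F z by (simp add: quasimodular_polys_def hol_polys_def coeff_map_def poly_conv_sum)
qed

lemma coeff_map_0_quasimodular:
  assumes "F \<in> quasimodular_polys m w \<Gamma>"
  shows "coeff_map 0 F \<in> quasimodular_forms m w \<Gamma>"
  unfolding quasimodular_forms_def
proof (intro CollectI conjI exI)
  show "is_quasi_coeffs m w \<Gamma> (coeff_map 0 F) (\<lambda>r. coeff_map r F)"
    by (rule is_quasi_coeffs_coeff_map[OF assms])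
  show "coeff_map 0 F holomorphic_on upper_half_plane"
    using assms by (simp add: coeff_map_def [abs_def] quasimodular_polys_def hol_polys_def)
qed

section \<open>The polynomial attached to a quasimodular form\<close>

lemma is_quasi_coeffs_quasi_poly:
  assumes "f \<in> quasimodular_forms m w \<Gamma>"
  shows "is_quasi_coeffs m w \<Gamma> f (\<lambda>r. coeff_map r (quasi_poly m w \<Gamma> f))"
proof -
  define c where "c = (SOME c. is_quasi_coeffs m w \<Gamma> f c)"
  have "\<exists>c. is_quasi_coeffs m w \<Gamma> f c"
    using assms by (simp add: quasimodular_forms_def)
  then have c: "is_quasi_coeffs m w \<Gamma> f c" unfolding c_def by (rule someI_ex)
  \<comment> \<open>Above m the polynomial has coefficient 0 whatever \<open>c\<close> is there, but
    \<open>is_quasi_coeffs\<close> inspects indices up to m only.\<close>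
  have "coeff_map r (quasi_poly m w \<Gamma> f) = c r" if "r \<le> m" for r
    using that by (simp add: fun_eq_iff coeff_map_def quasi_poly_def c_def[symmetric] coeff_sum)
  then show ?thesis using c by (simp add: is_quasi_coeffs_def)
qed

lemma hol_polys_quasi_poly:
  assumes "f \<in> quasimodular_forms m w \<Gamma>"
  shows "quasi_poly m w \<Gamma> f \<in> hol_polys m"
proof -
  have deg: "degree (quasi_poly m w \<Gamma> f z) \<le> m" for z
    unfolding quasi_poly_def Let_def
    by (intro degree_sum_le) (auto intro: order_trans[OF degree_monom_le])
  have "(\<lambda>z. coeff (quasi_poly m w \<Gamma> f z) r) holomorphic_on upper_half_plane" for r
  proof (cases "r \<le> m")
    case True
    then show ?thesis using is_quasi_coeffs_quasi_poly[OF assms]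
      by (simp add: is_quasi_coeffs_def coeff_map_def [abs_def])
  next
    case False
    then have "coeff (quasi_poly m w \<Gamma> f z) r = 0" for z
      using deg[of z] by (intro coeff_eq_0) simp
    then show ?thesis by simp
  qed
  with deg show ?thesis by (simp add: hol_polys_def)
qed

text \<open>The defining expansion in powers of K, read as a value of a polynomial; it is true of
  whichever family \<open>SOME\<close> selects.\<close>

lemma slash_eq_poly_quasi_poly:
  assumes f: "f \<in> quasimodular_forms m w \<Gamma>" and "\<gamma> \<in> \<Gamma>" "z \<in> upper_half_plane"
  shows "slash w f \<gamma> z = poly (quasi_poly m w \<Gamma> f z) (fac_K \<gamma> z)"
proof -
  have "degree (quasi_poly m w \<Gamma> f z) \<le> m"
    using hol_polys_quasi_poly[OF f] assms(3) by (simp add: hol_polys_def)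
  then show ?thesis
    using is_quasi_coeffs_quasi_poly[OF f] assms
    by (simp add: is_quasi_coeffs_def coeff_map_def poly_conv_sum)
qed

text \<open>Here determinacy enters: it settles the coefficients up to m, and the degree bounds
  settle the rest. Off the half plane nothing constrains the selected family.\<close>

lemma quasi_poly_eqI:
  assumes det: "quasi_coeffs_determined m w \<Gamma>" and f: "f \<in> quasimodular_forms m w \<Gamma>"
    and F: "F \<in> hol_polys m" and c: "is_quasi_coeffs m w \<Gamma> f (\<lambda>r. coeff_map r F)"
    and z: "z \<in> upper_half_plane"
  shows "quasi_poly m w \<Gamma> f z = F z"
proof (rule poly_eqI)
  fix r
  show "coeff (quasi_poly m w \<Gamma> f z) r = coeff (F z) r"
  proof (cases "r \<le> m")
    case True
    have "coeff_map r (quasi_poly m w \<Gamma> f) z = coeff_map r F z"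
      using det[unfolded quasi_coeffs_determined_def, rule_format,
          OF f is_quasi_coeffs_quasi_poly[OF f] c True z] .
    then show ?thesis by (simp add: coeff_map_def)
  next
    case False
    moreover have "degree (quasi_poly m w \<Gamma> f z) \<le> m" "degree (F z) \<le> m"
      using F z hol_polys_quasi_poly[OF f] by (simp_all add: hol_polys_def)
    ultimately show ?thesis by (simp add: coeff_eq_0)
  qed
qed

lemma quasi_poly_quasimodular:
  assumes det: "quasi_coeffs_determined m w \<Gamma>" and f: "f \<in> quasimodular_forms m w \<Gamma>"
  shows "quasi_poly m w \<Gamma> f \<in> quasimodular_polys m w \<Gamma>"
  unfolding quasimodular_polys_def
proof (intro CollectI conjI ballI)
  show "quasi_poly m w \<Gamma> f \<in> hol_polys m" by (rule hol_polys_quasi_poly[OF f])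
next
  let ?F = "quasi_poly m w \<Gamma> f"
  fix \<delta> z assume \<delta>: "\<delta> \<in> \<Gamma>" and z: "z \<in> upper_half_plane"
  have d: "det \<delta> > 0" using det_eq_1[OF \<delta>] by simp
  have hol: "slash_poly w ?F \<delta> \<in> hol_polys m"
    by (rule hol_polys_slash_poly[OF hol_polys_quasi_poly[OF f] d])
  have "slash w f \<gamma> z = (\<Sum>r\<le>m. coeff_map r (slash_poly w ?F \<delta>) z * fac_K \<gamma> z ^ r)"
    if \<gamma>: "\<gamma> \<in> \<Gamma>" and z: "z \<in> upper_half_plane" for \<gamma> z
  proof -
    \<comment> \<open>Write \<gamma> = \<beta>\<delta> with \<beta> = \<gamma>\<delta>^-1 in
      \<Gamma>; the expansion of f slashed by \<beta>, taken at the point \<delta>z, then yields one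
      for \<gamma> at z.\<close>
    obtain \<epsilon> where \<epsilon>: "\<epsilon> \<in> \<Gamma>" "\<epsilon> ** \<delta> = mat 1" using ex_inverse[OF \<delta>] .
    define \<beta> where "\<beta> = \<gamma> ** \<epsilon>"
    have \<beta>: "\<beta> \<in> \<Gamma>" "\<gamma> = \<beta> ** \<delta>"
      using \<epsilon> \<gamma> mult_mem by (auto simp: \<beta>_def matrix_mul_assoc[symmetric])
    have d\<beta>: "det \<beta> > 0" using det_eq_1[OF \<beta>(1)] by simp
    have \<delta>z: "moebius \<delta> z \<in> upper_half_plane" by (rule moebius_in_upper_half_plane[OF d z])
    have J: "fac_J \<delta> z \<noteq> 0" by (rule fac_J_nonzero[OF d z])
    have "slash w f \<gamma> z = slash w (slash w f \<beta>) \<delta> z"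
      unfolding \<beta>(2) by (rule slash_mult[OF d\<beta> d z])
    also have "\<dots> = fac_J \<delta> z powi (- w) * poly (?F (moebius \<delta> z)) (fac_K \<beta> (moebius \<delta> z))"
      by (simp add: slash_def[of w "slash w f \<beta>"] det_eq_1[OF \<delta>]
          slash_eq_poly_quasi_poly[OF f \<beta>(1) \<delta>z])
    \<comment> \<open>The cocycle rule for K solved for K(\<beta>,\<delta>z). As det \<delta> = 1,
      the right side is the polynomial substituted for X in the slash by \<delta>, evaluated at X =
      K(\<gamma>,z).\<close>
    also have "fac_K \<beta> (moebius \<delta> z) = (fac_J \<delta> z)\<^sup>2 * (fac_K \<gamma> z - fac_K \<delta> z)"
      using J unfolding \<beta>(2) fac_K_mult[OF d\<beta> d z] by (simp add: det_eq_1[OF \<delta>])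
    also have "fac_J \<delta> z powi (- w) * poly (?F (moebius \<delta> z)) \<dots>
        = poly (slash_poly w ?F \<delta> z) (fac_K \<gamma> z)"
      by (simp add: slash_poly_def poly_pcompose det_eq_1[OF \<delta>] algebra_simps)
    also have "\<dots> = (\<Sum>r\<le>m. coeff_map r (slash_poly w ?F \<delta>) z * fac_K \<gamma> z ^ r)"
      using hol z by (simp add: hol_polys_def coeff_map_def poly_conv_sum)
    finally show ?thesis .
  qed
  then have "is_quasi_coeffs m w \<Gamma> f (\<lambda>r. coeff_map r (slash_poly w ?F \<delta>))"
    using hol by (simp add: is_quasi_coeffs_def hol_polys_def coeff_map_def [abs_def])
  from quasi_poly_eqI[OF det f hol this z] show "slash_poly w ?F \<delta> z = ?F z" by simp
qed

lemma quasi_poly_coeff_map_0: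
  assumes "quasi_coeffs_determined m w \<Gamma>" and F: "F \<in> quasimodular_polys m w \<Gamma>"
    and "z \<in> upper_half_plane"
  shows "quasi_poly m w \<Gamma> (coeff_map 0 F) z = F z"
  using assms coeff_map_0_quasimodular[OF F] is_quasi_coeffs_coeff_map[OF F]
  by (intro quasi_poly_eqI) (auto simp: quasimodular_polys_def)

lemma hecke_Q_eq:
  "hecke_Q m w \<Gamma> R f = coeff_map 0 (hecke_P w R (quasi_poly m w \<Gamma> f))"
  by (simp add: fun_eq_iff hecke_Q_def hecke_P_def coeff_map_def coeff_sum)

end

text \<open>Using R on one side and R' on the other builds independence of the representatives into
  each identity. The membership claims ensure that the composed maps are applied to elements of
  their domains.\<close>

theorem theorem4p4:
  fixes \<Gamma> :: "(real^2^2) set" and m :: nat and \<xi> :: int and \<alpha> :: "real^2^2"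
    and R R' :: "(real^2^2) set"
  assumes "subgroup \<Gamma> SL2" and "discrete \<Gamma>"
    and "\<alpha> \<in> commensurator \<Gamma>"
    and "double_coset_reps \<Gamma> \<alpha> R" and "double_coset_reps \<Gamma> \<alpha> R'"
  shows "(quasi_coeffs_determined m \<xi> \<Gamma> \<longrightarrow>
           (\<forall>f\<in>quasimodular_forms m \<xi> \<Gamma>.
              quasi_poly m \<xi> \<Gamma> f \<in> quasimodular_polys m \<xi> \<Gamma> \<and>
              hecke_Q m \<xi> \<Gamma> R f \<in> quasimodular_forms m \<xi> \<Gamma> \<and>
              (\<forall>z\<in>upper_half_plane.
                 quasi_poly m \<xi> \<Gamma> (hecke_Q m \<xi> \<Gamma> R f) z
                   = hecke_P \<xi> R' (quasi_poly m \<xi> \<Gamma> f) z)))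
       \<and> (\<forall>F\<in>quasimodular_polys m \<xi> \<Gamma>.
              hecke_P \<xi> R F \<in> quasimodular_polys m \<xi> \<Gamma> \<and>
              coeff_map m F \<in> modular_forms (\<xi> - 2 * int m) \<Gamma> \<and>
              (\<forall>z\<in>upper_half_plane.
                 coeff_map m (hecke_P \<xi> R F) z
                   = hecke (\<xi> - 2 * int m) R' (coeff_map m F) z))"
proof -
  interpret SL2_subgroup \<Gamma> by (rule SL2_subgroup.intro) (rule assms(1))
  have \<alpha>: "det \<alpha> > 0" using assms(3) by (simp add: commensurator_def GL2_pos_def)
  note R = assms(4) and R' = assms(5)
  show ?thesis
  proof (intro conjI impI ballI)
    assume det: "quasi_coeffs_determined m \<xi> \<Gamma>"
    fix f assume f: "f \<in> quasimodular_forms m \<xi> \<Gamma>"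
    show Q: "quasi_poly m \<xi> \<Gamma> f \<in> quasimodular_polys m \<xi> \<Gamma>"
      by (rule quasi_poly_quasimodular[OF det f])
    note P = hecke_P_quasimodular[OF Q \<alpha> R]
    show "hecke_Q m \<xi> \<Gamma> R f \<in> quasimodular_forms m \<xi> \<Gamma>"
      unfolding hecke_Q_eq by (rule coeff_map_0_quasimodular[OF P])
    fix z assume z: "z \<in> upper_half_plane"
    show "quasi_poly m \<xi> \<Gamma> (hecke_Q m \<xi> \<Gamma> R f) z = hecke_P \<xi> R' (quasi_poly m \<xi> \<Gamma> f) z"
      \<comment> \<open>\<open>P\<close> allows recovering the polynomial formed with R from its
        constant term; only the change from R to R' is left.\<close>
      unfolding hecke_Q_eq quasi_poly_coeff_map_0[OF det P z]
      by (rule hecke_P_indep[OF Q \<alpha> R R' z])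
  next
    fix F assume F: "F \<in> quasimodular_polys m \<xi> \<Gamma>"
    show "hecke_P \<xi> R F \<in> quasimodular_polys m \<xi> \<Gamma>"
      by (rule hecke_P_quasimodular[OF F \<alpha> R])
    show "coeff_map m F \<in> modular_forms (\<xi> - 2 * int m) \<Gamma>"
      by (rule coeff_map_top_modular[OF F])
    fix z assume z: "z \<in> upper_half_plane"
    show "coeff_map m (hecke_P \<xi> R F) z = hecke (\<xi> - 2 * int m) R' (coeff_map m F) z"
      \<comment> \<open>Change from R to R' at the level of polynomials first, then compare top
        coefficients.\<close>
      using hecke_P_indep[OF F \<alpha> R R' z] coeff_map_top_hecke_P[OF F \<alpha> R' z]
      by (simp add: coeff_map_def)
  qed
qed

end
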